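(* Take $t$ with $\mathrm{Im}(t)\neq0$ and consider a ray $l$ (from $0$) not equal to any of the BPS rays $\{\pm i\mathbb{R}_-(t+n)\}_{n\in\mathbb{Z}}\cup i\mathbb{R}_\pm$. Let $S_l$ be any sector containing $l$ and no BPS rays. Then $$\mathcal X_{\beta^\vee}(t,\lambda)\,e^{-2\pi iZ_{\beta^\vee}(t)/\lambda}\to1\quad\text{as }\lambda\to0,\ \lambda\in S_l.$$
   Context: For $t$ with $\mathrm{Im}(t)\ne0$ and $\lambda\in\mathbb{C}^\times$ away from the BPS rays define $$I_n(t,\lambda):=-\frac{\lambda}{\pi i}\int_{i\mathbb{R}_-(t+n)}\frac{d\lambda'}{(\lambda')^2-\lambda^2}\log\big(1-e^{2\pi i(t+n)/\lambda'}\big),\qquad n\in\mathbb{Z},$$ the contour being the ray $i\mathbb{R}_-(t+n)=\{-i(t+n)s:s>0\}$ oriented from $0$ to $\infty$ (on which $e^{2\pi i(t+n)/\lambda'}=e^{-2\pi/s}\in(0,1)$), and $$\mathcal X_{\beta^\vee}(t,\lambda):=\exp\Big(\frac{2\pi iZ_{\beta^\vee}(t)}{\lambda}\Big)\,\mathcal X^{\mathrm{inst}}_{\beta^\vee}(t,\lambda),\qquad \log\mathcal X^{\mathrm{inst}}_{\beta^\vee}(t,\lambda):=I_0(t,\lambda)+\sum_{n>0}\big[I_n(t,\lambda)+I_{-n}(t,\lambda)\big],$$ a convergent (symmetrically summed) series. Here $Z_{\beta^\vee}(t)=-\frac1{(2\pi i)^2}\big(\frac12(\log e^{2\pi it})^2+\mathrm{Li}_2(e^{2\pi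 it})\big)$ (principal branches, or any fixed branch where these are discontinuous). Sectors have apex at $0$. *)

theory Defs
  imports "HOL-Complex_Analysis.Complex_Analysis"
begin

text \<open>The open ray from \<open>0\<close> through \<open>v\<close>; the apex is not included.\<close>

definition ray :: "complex \<Rightarrow> complex set" where
  "ray v = {of_real s * v | s::real. s > 0}"

text \<open>A sector with apex \<open>0\<close> (apex excluded): the points whose polar angle lies in a
  nondegenerate interval \<open>J\<close> of length at most \<open>2\<pi>\<close>.  The interval may be open, closed or
  half-open.\<close>

definition is_sector :: "complex set \<Rightarrow> bool" where
  "is_sector S \<longleftrightarrow> (\<exists>(a::real) b J. a < b \<and> b \<le> a + 2 * pi \<and>
     {a<..<b} \<subseteq> J \<and> J \<subseteq> {a..b} \<and>
     S = {of_real r * cis \<theta> | r \<theta>. r > 0 \<and> \<theta> \<in> J})"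

definition BPS_rays :: "complex \<Rightarrow> complex set set" where
  "BPS_rays t = {ray (\<i> * (t + of_int n)) | n::int. True}
     \<union> {ray (- \<i> * (t + of_int n)) | n::int. True}
     \<union> {ray \<i>, ray (- \<i>)}"

text \<open>The contour integral along \<open>ray v\<close>, oriented from \<open>0\<close> to \<open>\<infinity>\<close>, via the parametrisation
  \<open>s \<mapsto> s v\<close> with \<open>s > 0\<close>.\<close>

definition ray_integral :: "complex \<Rightarrow> (complex \<Rightarrow> complex) \<Rightarrow> complex" where
  "ray_integral v f = (LINT s:{0<..}|lborel. f (of_real s * v) * v)"

definition I_BPS :: "int \<Rightarrow> complex \<Rightarrow> complex \<Rightarrow> complex" where
  "I_BPS n t z = - (z / (of_real pi * \<i>)) *
     ray_integral (- \<i> * (t + of_int n))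
       (\<lambda>w. 1 / (w\<^sup>2 - z\<^sup>2) * Ln (1 - exp (2 * of_real pi * \<i> * (t + of_int n) / w)))"

text \<open>The principal branch \<open>Li\<^sub>2(x) = - \<integral>\<^sub>0\<^sup>x log(1 - u)/u du\<close>, integrated along the
  straight segment with the principal logarithm; on the cut \<open>(1,\<infinity>)\<close> the convention
  \<open>Im (Ln u) = \<pi>\<close> for negative \<open>u\<close> selects the value, namely the limit from below.\<close>

definition dilog :: "complex \<Rightarrow> complex" where
  "dilog x = - contour_integral (linepath 0 x) (\<lambda>u. Ln (1 - u) / u)"

definition Z_beta :: "complex \<Rightarrow> complex" where
  "Z_beta t = - (1 / (2 * of_real pi * \<i>)\<^sup>2) *
     ((Ln (exp (2 * of_real pi * \<i> * t)))\<^sup>2 / 2 + dilog (exp (2 * of_real pi * \<i> * t)))"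

text \<open>The sum over \<open>n > 0\<close> pairs the terms of index \<open>n\<close> and \<open>-n\<close>, and is indexed here by
  \<open>n = Suc k\<close>.\<close>

definition log_X_inst :: "complex \<Rightarrow> complex \<Rightarrow> complex" where
  "log_X_inst t z = I_BPS 0 t z +
     (\<Sum>k. I_BPS (int (Suc k)) t z + I_BPS (- int (Suc k)) t z)"

definition X_inst :: "complex \<Rightarrow> complex \<Rightarrow> complex" where
  "X_inst t z = exp (log_X_inst t z)"

definition X_beta :: "complex \<Rightarrow> complex \<Rightarrow> complex" where
  "X_beta t z = exp (2 * of_real pi * \<i> * Z_beta t / z) * X_inst t z"

end

theory Submission
  imports Defs "HOL-Real_Asymp.Real_Asymp"
begin

text \<open>
  Put \<open>w = t + n\<close> and \<open>q = w / \<lambda>\<close>.  After the substitution \<open>u = 1 / s\<close> on the contour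
  \<open>\<lambda>' = - \<i> w s\<close>, the integral \<open>I\<^sub>n(t, \<lambda>)\<close> depends on \<open>q\<close> alone and becomes
  \[ B(q) = - \frac{1}{\pi} \int_0^\infty \frac{q}{q^2 + u^2} \log (1 - e^{- 2 \pi u}) \, du , \]
  which for \<open>Re q > 0\<close> is Binet's integral for the remainder in Stirling's formula for
  \<open>log \<Gamma>(q)\<close>; it is odd in \<open>q\<close> (\<open>binet\<close>, \<open>I_BPS_eq_binet\<close>).  The point \<open>\<lambda>\<close> lies off the rays
  \<open>\<plusminus> \<i> (t + n)\<close> exactly when \<open>Re q \<noteq> 0\<close>, so that \<open>B\<close> is defined there.

  Everything rests on one estimate (\<open>binet_asymptotics\<close>),
  \[ \Big| B(q) - \frac{1}{12 q} \Big| \le \frac{1}{24 |q|^2} \qquad (Re\ q \ne 0), \]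
  uniformly up to the imaginary axis.  The uniformity matters because \<open>S\<close> may be an open sector
  bounded by BPS rays, so that \<open>\<lambda>\<close> can approach \<open>0\<close> tangentially to a contour and the integrand
  acquires a pole arbitrarily close to the path of integration.  The estimate survives because the
  Laplace transform turns the poles into oscillations: for \<open>Re q > 0\<close>, the
  factor \<open>1 / (q - \<i> u)\<close> equals \<open>\<integral>\<^sub>0\<^sup>\<infinity> e\<^sup>-\<^sup>s\<^sup>q e\<^sup>\<i>\<^sup>s\<^sup>u ds\<close>, and after exchanging the integrals
  \<open>Re q\<close> enters only through \<open>|e\<^sup>-\<^sup>s\<^sup>q| \<le> 1\<close> (\<open>laplace_swap\<close>, \<open>resolvent_moment_bound\<close>).
  Expanding the logarithm into exponentials \<open>e\<^sup>-\<^sup>a\<^sup>u\<close> with \<open>a = 2 \<pi> k\<close> reduces the estimate to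
  \<open>laplace_binet_kernel\<close>, and the constants come from \<open>\<Sum> 1/k\<^sup>2 = \<pi>\<^sup>2/6\<close>.

  In terms of \<open>\<lambda>\<close> the estimate reads
  \<open>I\<^sub>n = \<lambda> / (12 (t + n)) + O(|\<lambda>|\<^sup>2 / |t + n|\<^sup>2)\<close>.  The leading terms are not absolutely summable
  over \<open>n\<close>, but those of \<open>n\<close> and \<open>- n\<close> add up to \<open>\<lambda> t / (6 (t + n)(t - n))\<close>.  Hence the whole
  symmetric sum is \<open>O(|\<lambda>| + |\<lambda>|\<^sup>2)\<close> (\<open>log_X_inst_bound\<close>), and its exponential tends to \<open>1\<close>.
  The sector enters through the fact that with a point \<open>\<lambda>\<close> it contains the ray through \<open>\<lambda>\<close>,
  which therefore is not a BPS ray.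
\<close>

section \<open>Integrals over the half line\<close>

lemma set_integrable_half_line_dominated:
  fixes f :: "real \<Rightarrow> 'a::{banach, second_countable_topology}"
  assumes "set_integrable lborel {0<..} g" and "continuous_on {0<..} f"
    and "\<And>x. 0 < x \<Longrightarrow> norm (f x) \<le> (g x :: real)"
  shows "set_integrable lborel {0<..} f"
proof (rule set_integrable_bound[OF assms(1)])
  show "set_borel_measurable lborel {0<..} f"
    using set_measurable_continuous_on[of "{0<..}" f] assms(2)
    by (simp add: set_borel_measurable_def)
  have "norm (f x) \<le> norm (g x)" if "0 < x" for x
    using assms(3)[OF that] by simp
  then show "AE x in lborel. x \<in> {0<..} \<longrightarrow> norm (f x) \<le> norm (g x)" by simp
qed

text \<open>If \<open>f\<close> is not integrable, its integral is \<open>0\<close> by convention, while the right side is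
  nonnegative.\<close>

lemma norm_set_integral_le:
  fixes f :: "'b \<Rightarrow> 'a::{banach, second_countable_topology}"
  assumes "set_integrable M A g" and "\<And>x. x \<in> A \<Longrightarrow> norm (f x) \<le> (g x :: real)"
  shows "norm (LINT x:A|M. f x) \<le> (LINT x:A|M. g x)"
proof (cases "set_integrable M A f")
  case True
  then show ?thesis
    using assms unfolding set_integrable_def set_lebesgue_integral_def
    by (intro integral_norm_bound[THEN order_trans] integral_mono integrable_norm) (auto split: split_indicator)
next
  case False
  have "0 \<le> g x" if "x \<in> A" for x
    using assms(2)[OF that] norm_ge_zero[of "f x"] by linarith
  then have "0 \<le> (LINT x:A|M. g x)"
    unfolding set_lebesgue_integral_def
    by (intro integral_nonneg_AE) (auto split: split_indicator)
  with False show ?thesis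
    by (simp add: set_lebesgue_integral_def set_integrable_def not_integrable_integral_eq)
qed

lemma FTC_half_line:
  fixes f F :: "real \<Rightarrow> 'a::euclidean_space"
  assumes "\<And>x. (F has_vector_derivative f x) (at x)" and "continuous_on UNIV f"
    and "set_integrable lborel {0<..} f" and "(F \<longlongrightarrow> B) at_top"
  shows "(LINT x:{0<..}|lborel. f x) = B - F 0"
proof -
  have "isCont F 0"
    using assms(1) has_vector_derivative_continuous by blast
  then have "(F \<longlongrightarrow> F 0) (at_right 0)"
    by (meson filterlim_at_split isContD)
  then have "(LBINT x=ereal 0..\<infinity>. f x) = B - F 0"
    using assms
    by (intro interval_integral_FTC_integrable)
       (auto simp: ereal_tendsto_simps continuous_on_eq_continuous_at)
  then show ?thesis by (simp add: interval_integral_to_infinity_eq)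
qed

lemma FTC_half_line_nonneg:
  fixes f F :: "real \<Rightarrow> real"
  assumes "\<And>x. (F has_field_derivative f x) (at x)" and "continuous_on UNIV f"
    and "\<And>x. 0 < x \<Longrightarrow> 0 \<le> f x" and "(F \<longlongrightarrow> B) at_top"
  shows "set_integrable lborel {0<..} f" and "(LINT x:{0<..}|lborel. f x) = B - F 0"
proof -
  have "isCont F 0"
    using assms(1) DERIV_isCont by blast
  then have "(F \<longlongrightarrow> F 0) (at_right 0)"
    by (meson filterlim_at_split isContD)
  then have "set_integrable lborel (einterval (ereal 0) \<infinity>) f"
    "(LBINT x=ereal 0..\<infinity>. f x) = B - F 0"
    using assms
    by (intro interval_integral_FTC_nonneg[where F = F and A = "F 0" and B = B];
       auto simp: ereal_tendsto_simps continuous_on_eq_continuous_at)+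
  then show "set_integrable lborel {0<..} f" and "(LINT x:{0<..}|lborel. f x) = B - F 0"
    by (simp_all add: interval_integral_to_infinity_eq)
qed

lemma exp_half_line:
  fixes a :: real
  assumes "0 < a"
  shows "set_integrable lborel {0<..} (\<lambda>s. exp (- (a * s)))"
    and "(LINT s:{0<..}|lborel. exp (- (a * s))) = 1 / a"
proof -
  define F where "F = (\<lambda>s. - exp (- (a * s)) / a)"
  have d: "(F has_field_derivative exp (- (a * s))) (at s)" for s
    unfolding F_def using assms by (auto intro!: derivative_eq_intros)
  have l: "(F \<longlongrightarrow> 0) at_top"
    unfolding F_def using assms by real_asymp
  have c: "continuous_on UNIV (\<lambda>s. exp (- (a * s)))"
    by (intro continuous_intros)
  show "set_integrable lborel {0<..} (\<lambda>s. exp (- (a * s)))"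
    and "(LINT s:{0<..}|lborel. exp (- (a * s))) = 1 / a"
    using FTC_half_line_nonneg[OF d c _ l] by (auto simp: F_def)
qed

lemma square_exp_half_line:
  fixes a :: real
  assumes "0 < a"
  shows "set_integrable lborel {0<..} (\<lambda>u. u\<^sup>2 * exp (- (a * u)))"
    and "(LINT u:{0<..}|lborel. u\<^sup>2 * exp (- (a * u))) = 2 / a ^ 3"
proof -
  define F where "F = (\<lambda>u. - (u\<^sup>2 / a + 2 * u / a\<^sup>2 + 2 / a ^ 3) * exp (- (a * u)))"
  have d: "(F has_field_derivative u\<^sup>2 * exp (- (a * u))) (at u)" for u
    unfolding F_def using assms
    by (auto intro!: derivative_eq_intros simp: field_simps power2_eq_square power3_eq_cube)
  have l: "(F \<longlongrightarrow> 0) at_top"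
    unfolding F_def using assms by real_asymp
  have c: "continuous_on UNIV (\<lambda>u. u\<^sup>2 * exp (- (a * u)))"
    by (intro continuous_intros)
  show "set_integrable lborel {0<..} (\<lambda>u. u\<^sup>2 * exp (- (a * u)))"
    and "(LINT u:{0<..}|lborel. u\<^sup>2 * exp (- (a * u))) = 2 / a ^ 3"
    using FTC_half_line_nonneg[OF d c _ l] by (auto simp: F_def)
qed

lemma arctan_half_line:
  fixes a :: real
  assumes "0 < a"
  shows "set_integrable lborel {0<..} (\<lambda>s. 1 / (a\<^sup>2 + s\<^sup>2))"
    and "(LINT s:{0<..}|lborel. 1 / (a\<^sup>2 + s\<^sup>2)) = pi / (2 * a)"
proof -
  define F where "F = (\<lambda>s. arctan (s / a) / a)"
  have nz: "a\<^sup>2 + s\<^sup>2 \<noteq> 0" for s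
    using assms by (simp add: sum_power2_eq_zero_iff)
  have d: "(F has_field_derivative 1 / (a\<^sup>2 + s\<^sup>2)) (at s)" for s
    unfolding F_def using assms nz[of s]
    by (auto intro!: derivative_eq_intros simp: divide_simps power2_eq_square)
  have l: "(F \<longlongrightarrow> pi / (2 * a)) at_top"
    unfolding F_def using assms by (real_asymp simp: field_simps)
  have c: "continuous_on UNIV (\<lambda>s. 1 / (a\<^sup>2 + s\<^sup>2))"
    using nz by (intro continuous_intros) auto
  show "set_integrable lborel {0<..} (\<lambda>s. 1 / (a\<^sup>2 + s\<^sup>2))"
    and "(LINT s:{0<..}|lborel. 1 / (a\<^sup>2 + s\<^sup>2)) = pi / (2 * a)"
    using FTC_half_line_nonneg[OF d c _ l] by (auto simp: F_def)
qed

lemma complex_exp_half_line: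
  fixes c :: complex
  assumes "0 < Re c"
  shows "set_integrable lborel {0<..} (\<lambda>s. exp (- (c * of_real s)))"
    and "(LINT s:{0<..}|lborel. exp (- (c * of_real s))) = 1 / c"
proof -
  define F where "F = (\<lambda>s. - exp (- (c * of_real s)) / c)"
  have "c \<noteq> 0" using assms by auto
  then have d: "(F has_vector_derivative exp (- (c * of_real s))) (at s)" for s
    unfolding F_def
    by (auto intro!: derivative_eq_intros has_vector_derivative_real_field)
  have "((\<lambda>s. exp (- (Re c * s)) / norm c) \<longlongrightarrow> 0) at_top"
    using assms \<open>c \<noteq> 0\<close> by real_asymp
  then have l: "(F \<longlongrightarrow> 0) at_top"
    by (subst tendsto_norm_zero_iff[symmetric]) (simp add: F_def norm_divide norm_exp_eq_Re)
  have c: "continuous_on UNIV (\<lambda>s. exp (- (c * of_real s)))"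
    by (intro continuous_intros)
  show i: "set_integrable lborel {0<..} (\<lambda>s. exp (- (c * of_real s)))"
    by (rule set_integrable_half_line_dominated[OF exp_half_line(1)[OF assms]])
       (auto intro!: continuous_intros simp: norm_exp_eq_Re)
  show "(LINT s:{0<..}|lborel. exp (- (c * of_real s))) = 1 / c"
    using FTC_half_line[OF d c i l] by (simp add: F_def)
qed

lemma complex_square_exp_half_line:
  fixes c :: complex
  assumes "0 < Re c"
  shows "(LINT u:{0<..}|lborel. (of_real u)\<^sup>2 * exp (- (c * of_real u))) = 2 / c ^ 3"
proof -
  define F where "F = (\<lambda>u. - ((of_real u)\<^sup>2 / c + 2 * of_real u / c\<^sup>2 + 2 / c ^ 3) * exp (- (c * of_real u)))"
  have "c \<noteq> 0" using assms by auto
  have d: "(F has_vector_derivative (of_real u)\<^sup>2 * exp (- (c * of_real u))) (at u)" for u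
    unfolding F_def using \<open>c \<noteq> 0\<close>
    by (auto intro!: derivative_eq_intros has_vector_derivative_real_field
             simp: field_simps power2_eq_square power3_eq_cube)
  have "((\<lambda>u. (u\<^sup>2 / norm c + 2 * \<bar>u\<bar> / (norm c)\<^sup>2 + 2 / norm c ^ 3) * exp (- (Re c * u))) \<longlongrightarrow> 0) at_top"
    using assms \<open>c \<noteq> 0\<close> by real_asymp
  then have l: "(F \<longlongrightarrow> 0) at_top"
  proof (rule Lim_null_comparison[rotated], intro always_eventually allI)
    show "norm (F u) \<le> (u\<^sup>2 / norm c + 2 * \<bar>u\<bar> / (norm c)\<^sup>2 + 2 / norm c ^ 3) * exp (- (Re c * u))" for u
      unfolding F_def norm_mult norm_minus_cancel norm_exp_eq_Re
      by (intro mult_mono norm_triangle_le add_mono) (auto simp: norm_divide norm_mult norm_power)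
  qed
  have c: "continuous_on UNIV (\<lambda>u. (of_real u)\<^sup>2 * exp (- (c * of_real u)))"
    by (intro continuous_intros)
  have i: "set_integrable lborel {0<..} (\<lambda>u. (of_real u)\<^sup>2 * exp (- (c * of_real u)))"
    by (rule set_integrable_half_line_dominated[OF square_exp_half_line(1)[OF assms]])
       (auto intro!: continuous_intros simp: norm_exp_eq_Re norm_mult norm_power)
  show ?thesis
    using FTC_half_line[OF d c i l] by (simp add: F_def)
qed

section \<open>A resolvent bound uniform up to the imaginary axis\<close>

text \<open>Both sides are the double integral of \<open>u\<^sup>2 e\<^sup>-\<^sup>a\<^sup>u e\<^sup>-\<^sup>s\<^sup>(\<^sup>q\<^sup>-\<^sup>\<i>\<^sup>\<sigma>\<^sup>u\<^sup>)\<close> over \<open>u, s > 0\<close>, with the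
  inner integral taken over \<open>s\<close> and over \<open>u\<close> respectively.  The left side has a pole near the path of
  integration when \<open>q\<close> is near the imaginary axis; the right side has none, since its denominator
  involves \<open>a\<close> instead of \<open>q\<close>.\<close>

lemma laplace_swap:
  fixes q :: complex and a \<sigma> :: real
  assumes "0 < Re q" "0 < a"
  shows "(LINT u:{0<..}|lborel. (of_real u)\<^sup>2 * exp (- (of_real a * of_real u)) / (q - \<i> * of_real (\<sigma> * u)))
       = (LINT s:{0<..}|lborel. exp (- (q * of_real s)) * (2 / (of_real a - \<i> * of_real (\<sigma> * s)) ^ 3))"
proof -
  let ?k = "\<lambda>u s. (of_real u)\<^sup>2 * exp (- (of_real a * of_real u)) * exp (- ((q - \<i> * of_real (\<sigma> * u)) * of_real s)) :: complex"
  define f where "f u s = indicat_real {0<..} u *\<^sub>R indicat_real {0<..} s *\<^sub>R ?k u s" for u s :: real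
  have norm_f: "norm (f u s) = (indicat_real {0<..} u *\<^sub>R (u\<^sup>2 * exp (- (a * u)))) *
      (indicat_real {0<..} s *\<^sub>R exp (- (Re q * s)))" for u s
    by (simp add: f_def norm_mult norm_power norm_exp_eq_Re split: split_indicator)
  have inner_s: "(LINT s|lborel. f u s) =
      indicat_real {0<..} u *\<^sub>R ((of_real u)\<^sup>2 * exp (- (of_real a * of_real u)) / (q - \<i> * of_real (\<sigma> * u)))" for u
  proof -
    have "(LINT s|lborel. f u s) = indicat_real {0<..} u *\<^sub>R (LINT s:{0<..}|lborel. ?k u s)"
      unfolding f_def set_lebesgue_integral_def by (subst integral_scaleR_right) simp
    also have "(LINT s:{0<..}|lborel. ?k u s) = (of_real u)\<^sup>2 * exp (- (of_real a * of_real u)) *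
        (LINT s:{0<..}|lborel. exp (- ((q - \<i> * of_real (\<sigma> * u)) * of_real s)))"
      by (rule set_integral_mult_right)
    also have "(LINT s:{0<..}|lborel. exp (- ((q - \<i> * of_real (\<sigma> * u)) * of_real s))) = 1 / (q - \<i> * of_real (\<sigma> * u))"
      using assms by (intro complex_exp_half_line) simp
    finally show ?thesis by simp
  qed
  have inner_u: "(LINT u|lborel. f u s) =
      indicat_real {0<..} s *\<^sub>R (exp (- (q * of_real s)) * (2 / (of_real a - \<i> * of_real (\<sigma> * s)) ^ 3))" for s
  proof -
    have k: "?k u s = exp (- (q * of_real s)) * ((of_real u)\<^sup>2 * exp (- ((of_real a - \<i> * of_real (\<sigma> * s)) * of_real u)))" for u
    proof -
      have "exp (- (of_real a * of_real u)) * exp (- ((q - \<i> * of_real (\<sigma> * u)) * of_real s))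
          = exp (- (q * of_real s)) * exp (- ((of_real a - \<i> * of_real (\<sigma> * s)) * of_real u))"
        unfolding exp_add[symmetric] by (simp add: algebra_simps)
      then show ?thesis by (simp only: mult_ac)
    qed
    have "(LINT u|lborel. f u s) = (LINT u|lborel. indicat_real {0<..} s *\<^sub>R indicat_real {0<..} u *\<^sub>R ?k u s)"
      by (simp add: f_def mult.commute)
    also have "\<dots> = indicat_real {0<..} s *\<^sub>R (LINT u:{0<..}|lborel. ?k u s)"
      unfolding set_lebesgue_integral_def by (subst integral_scaleR_right) simp
    also have "(LINT u:{0<..}|lborel. ?k u s) = exp (- (q * of_real s)) *
        (LINT u:{0<..}|lborel. (of_real u)\<^sup>2 * exp (- ((of_real a - \<i> * of_real (\<sigma> * s)) * of_real u)))"
      unfolding k by (rule set_integral_mult_right)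
    also have "(LINT u:{0<..}|lborel. (of_real u)\<^sup>2 * exp (- ((of_real a - \<i> * of_real (\<sigma> * s)) * of_real u)))
        = 2 / (of_real a - \<i> * of_real (\<sigma> * s)) ^ 3"
      using assms by (intro complex_square_exp_half_line) simp
    finally show ?thesis .
  qed
  have meas: "case_prod f \<in> borel_measurable (lborel \<Otimes>\<^sub>M lborel)"
    unfolding f_def by measurable
  have int_s: "integrable lborel (\<lambda>s. indicat_real {0<..} s *\<^sub>R exp (- (Re q * s)))"
    using exp_half_line(1)[OF assms(1)] by (simp add: set_integrable_def)
  have int_u: "integrable lborel (\<lambda>u. indicat_real {0<..} u *\<^sub>R (u\<^sup>2 * exp (- (a * u))))"
    using square_exp_half_line(1)[OF assms(2)] by (simp add: set_integrable_def)
  have "integrable (lborel \<Otimes>\<^sub>M lborel) (case_prod f)"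
  proof (rule lborel_pair.Fubini_integrable[OF meas])
    show "integrable lborel (\<lambda>u. LINT s|lborel. norm (case_prod f (u, s)))"
      unfolding prod.case norm_f integral_mult_right_zero
      by (intro integrable_mult_left int_u)
    have "integrable lborel (f u)" for u
    proof (rule Bochner_Integration.integrable_bound)
      show "integrable lborel (\<lambda>s. norm (f u s))"
        unfolding norm_f by (intro integrable_mult_right int_s)
      show "f u \<in> borel_measurable lborel"
        unfolding f_def by measurable
    qed simp
    then show "AE u in lborel. integrable lborel (\<lambda>s. case_prod f (u, s))" by simp
  qed
  from lborel_pair.Fubini_integral[OF this]
  have "(LINT u|lborel. LINT s|lborel. f u s) = (LINT s|lborel. LINT u|lborel. f u s)" by simp
  then show ?thesis
    unfolding inner_s inner_u set_lebesgue_integral_def .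
qed

text \<open>The factor \<open>u\<^sup>2\<close> produces the cube \<open>|a - \<i> \<sigma> s|\<^sup>3 \<ge> a (a\<^sup>2 + s\<^sup>2)\<close> in the denominator, which is
  integrable in \<open>s\<close> without help from the factor \<open>e\<^sup>-\<^sup>s\<^sup>q\<close>.  Bounding that factor by \<open>1\<close> gives a bound
  in which \<open>q\<close> does not occur.\<close>

lemma resolvent_moment_bound:
  fixes q :: complex and a \<sigma> :: real
  assumes "0 < Re q" "0 < a" "\<sigma>\<^sup>2 = 1"
  shows "norm (LINT u:{0<..}|lborel. (of_real u)\<^sup>2 * exp (- (of_real a * of_real u)) / (q - \<i> * of_real (\<sigma> * u)))
     \<le> pi / a\<^sup>2"
proof -
  have "norm (LINT s:{0<..}|lborel. exp (- (q * of_real s)) * (2 / (of_real a - \<i> * of_real (\<sigma> * s)) ^ 3))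
      \<le> (LINT s:{0<..}|lborel. 2 / a * (1 / (a\<^sup>2 + s\<^sup>2)))"
  proof (rule norm_set_integral_le)
    show "set_integrable lborel {0<..} (\<lambda>s. 2 / a * (1 / (a\<^sup>2 + s\<^sup>2)))"
      using arctan_half_line(1)[OF assms(2)] by (intro set_integrable_mult_right)
    fix s :: real assume s: "s \<in> {0<..}"
    define r where "r = norm (of_real a - \<i> * of_real (\<sigma> * s))"
    have r2: "r\<^sup>2 = a\<^sup>2 + s\<^sup>2"
      using assms(3) by (simp add: r_def cmod_power2 power_mult_distrib)
    have ra: "a \<le> r"
      using complex_Re_le_cmod[of "of_real a - \<i> * of_real (\<sigma> * s)"] by (simp add: r_def)
    have "norm (exp (- (q * of_real s))) \<le> 1"
      using assms(1) s by (simp add: norm_exp_eq_Re)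
    then have "norm (exp (- (q * of_real s)) * (2 / (of_real a - \<i> * of_real (\<sigma> * s)) ^ 3)) \<le> 1 * (2 / r ^ 3)"
      unfolding norm_mult by (intro mult_mono) (auto simp: norm_divide norm_power r_def)
    also have "\<dots> \<le> 2 / (a * r\<^sup>2)"
      using ra assms(2) by (auto simp: power3_eq_cube power2_eq_square intro!: divide_left_mono mult_right_mono)
    finally show "norm (exp (- (q * of_real s)) * (2 / (of_real a - \<i> * of_real (\<sigma> * s)) ^ 3))
        \<le> 2 / a * (1 / (a\<^sup>2 + s\<^sup>2))"
      by (simp add: r2)
  qed
  also have "\<dots> = pi / a\<^sup>2"
    using assms(2) unfolding set_integral_mult_right arctan_half_line(2)[OF assms(2)]
    by (simp add: power2_eq_square)
  finally show ?thesis
    unfolding laplace_swap[OF assms(1,2)] .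
qed

section \<open>The Laplace transform of Binet's kernel\<close>

lemma Re_nonzero_shift:
  fixes q :: complex
  assumes "Re q \<noteq> 0"
  shows "q - \<i> * of_real x \<noteq> 0" "q + \<i> * of_real x \<noteq> 0" "q\<^sup>2 + (of_real x)\<^sup>2 \<noteq> 0"
proof -
  show 1: "q - \<i> * of_real x \<noteq> 0" "q + \<i> * of_real x \<noteq> 0"
    using assms by (auto simp: complex_eq_iff)
  have "q\<^sup>2 + (of_real x)\<^sup>2 = (q - \<i> * of_real x) * (q + \<i> * of_real x)"
    by (simp add: algebra_simps power2_eq_square)
  with 1 show "q\<^sup>2 + (of_real x)\<^sup>2 \<noteq> 0" by simp
qed

lemma norm_resolvent_le:
  fixes q :: complex
  assumes "Re q \<noteq> 0"
  shows "norm (1 / (q - \<i> * of_real x)) \<le> 1 / \<bar>Re q\<bar>"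
proof -
  have "\<bar>Re q\<bar> \<le> norm (q - \<i> * of_real x)"
    using abs_Re_le_cmod[of "q - \<i> * of_real x"] by simp
  then show ?thesis
    using assms by (simp add: norm_divide frac_le)
qed

lemma binet_kernel_partial_fractions:
  fixes q :: complex
  assumes "Re q \<noteq> 0"
  shows "q / (q\<^sup>2 + (of_real x)\<^sup>2) = (1 / (q - \<i> * of_real x) + 1 / (q + \<i> * of_real x)) / 2"
  using Re_nonzero_shift[OF assms, of x]
  by (simp add: divide_simps) (simp add: algebra_simps power2_eq_square power3_eq_cube)

text \<open>This bound blows up as \<open>q\<close> approaches the imaginary axis.  It serves only to establish
  convergence for a fixed \<open>q\<close>.\<close>

lemma norm_binet_kernel_le:
  fixes q :: complex
  assumes "Re q \<noteq> 0"
  shows "norm (q / (q\<^sup>2 + (of_real x)\<^sup>2)) \<le> 1 / \<bar>Re q\<bar>"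
proof -
  have "norm (1 / (q - \<i> * of_real x) + 1 / (q + \<i> * of_real x)) \<le> 2 * (1 / \<bar>Re q\<bar>)"
    using norm_resolvent_le[OF assms, of x] norm_resolvent_le[OF assms, of "- x"]
    by (intro norm_triangle_le) simp
  then show ?thesis
    unfolding binet_kernel_partial_fractions[OF assms] by (simp add: norm_divide)
qed

lemma continuous_on_binet_kernel:
  fixes q :: complex
  assumes "Re q \<noteq> 0"
  shows "continuous_on A (\<lambda>u. q / (q\<^sup>2 + (of_real u)\<^sup>2))"
  using Re_nonzero_shift(3)[OF assms] by (intro continuous_intros) auto

lemma set_integrable_binet_kernel_exp:
  fixes q :: complex
  assumes "Re q \<noteq> 0" "0 < a"
  shows "set_integrable lborel {0<..} (\<lambda>u. q / (q\<^sup>2 + (of_real u)\<^sup>2) * of_real (exp (- (a * u))))"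
proof (rule set_integrable_half_line_dominated)
  show "set_integrable lborel {0<..} (\<lambda>u. 1 / \<bar>Re q\<bar> * exp (- (a * u)))"
    using exp_half_line(1)[OF assms(2)] by (intro set_integrable_mult_right)
  show "norm (q / (q\<^sup>2 + (of_real u)\<^sup>2) * of_real (exp (- (a * u)))) \<le> 1 / \<bar>Re q\<bar> * exp (- (a * u))" for u
    unfolding norm_mult using norm_binet_kernel_le[OF assms(1), of u] by (intro mult_mono) auto
qed (intro continuous_intros continuous_on_binet_kernel assms)

text \<open>Subtracting the leading term from the kernel leaves \<open>q / (q\<^sup>2 + u\<^sup>2) - 1 / q\<close>, which is
  \<open>- (u\<^sup>2 / q\<^sup>2) \<cdot> q / (q\<^sup>2 + u\<^sup>2)\<close>.  The power \<open>1 / q\<^sup>2\<close> is the wanted order, and what remains is the mean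
  of the two integrals bounded in \<open>resolvent_moment_bound\<close>, for \<open>\<sigma> = \<plusminus> 1\<close>.\<close>

lemma laplace_binet_kernel_right:
  fixes q :: complex
  assumes "0 < Re q" "0 < a"
  shows "norm ((LINT u:{0<..}|lborel. q / (q\<^sup>2 + (of_real u)\<^sup>2) * of_real (exp (- (a * u)))) - 1 / (of_real a * q))
    \<le> pi / (a * norm q)\<^sup>2"
proof -
  define R where "R \<sigma> u = (of_real u)\<^sup>2 * exp (- (of_real a * of_real u)) / (q - \<i> * of_real (\<sigma> * u))" for \<sigma> u :: real
  have Re: "Re q \<noteq> 0" and "q \<noteq> 0" using assms(1) by auto
  have int: "set_integrable lborel {0<..} (R \<sigma>)" for \<sigma>
  proof (rule set_integrable_half_line_dominated)
    show "set_integrable lborel {0<..} (\<lambda>u. u\<^sup>2 * exp (- (a * u)) * (1 / \<bar>Re q\<bar>))"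
      using square_exp_half_line(1)[OF assms(2)] by (intro set_integrable_mult_left)
    show "continuous_on {0<..} (R \<sigma>)"
      unfolding R_def using Re_nonzero_shift(1)[OF Re] by (intro continuous_intros) blast
    show "norm (R \<sigma> u) \<le> u\<^sup>2 * exp (- (a * u)) * (1 / \<bar>Re q\<bar>)" for u
    proof -
      have "norm (R \<sigma> u) = u\<^sup>2 * exp (- (a * u)) * norm (1 / (q - \<i> * of_real (\<sigma> * u)))"
        unfolding R_def by (simp add: norm_mult norm_divide norm_power norm_exp_eq_Re)
      then show ?thesis
        using norm_resolvent_le[OF Re, of "\<sigma> * u"] by (simp add: mult_left_mono del: times_divide_eq_right)
    qed
  qed
  have split: "q / (q\<^sup>2 + (of_real u)\<^sup>2) * of_real (exp (- (a * u)))
      = 1 / q * exp (- (of_real a * of_real u)) - 1 / (2 * q\<^sup>2) * (R 1 u + R (- 1) u)" for u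
  proof -
    have kernel: "1 / q - (of_real u)\<^sup>2 / (2 * q\<^sup>2) * (1 / (q - \<i> * of_real u) + 1 / (q + \<i> * of_real u))
        = q / (q\<^sup>2 + (of_real u)\<^sup>2)"
    proof -
      have "1 / (q - \<i> * of_real u) + 1 / (q + \<i> * of_real u) = 2 * (q / (q\<^sup>2 + (of_real u)\<^sup>2))"
        unfolding binet_kernel_partial_fractions[OF Re] by simp
      show ?thesis
        unfolding \<open>1 / _ + 1 / _ = _\<close>
        using Re_nonzero_shift(3)[OF Re, of u] \<open>q \<noteq> 0\<close>
        by (simp add: divide_simps) (simp add: algebra_simps power2_eq_square)
    qed
    have "R 1 u + R (- 1) u = exp (- (of_real a * of_real u)) *
        ((of_real u)\<^sup>2 * (1 / (q - \<i> * of_real u) + 1 / (q + \<i> * of_real u)))"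
      unfolding R_def by (simp add: algebra_simps)
    moreover have "complex_of_real (exp (- (a * u))) = exp (- (of_real a * of_real u))"
      by (simp flip: exp_of_real)
    ultimately show ?thesis
      unfolding kernel[symmetric] by (simp add: field_simps)
  qed
  have int_exp: "set_integrable lborel {0<..} (\<lambda>u. exp (- (of_real a * of_real u)) :: complex)"
    and lint_exp: "(LINT u:{0<..}|lborel. exp (- (of_real a * of_real u)) :: complex) = 1 / of_real a"
    using complex_exp_half_line[of "of_real a"] assms(2) by simp_all
  have "(LINT u:{0<..}|lborel. q / (q\<^sup>2 + (of_real u)\<^sup>2) * of_real (exp (- (a * u))))
      = 1 / q * (1 / of_real a) - 1 / (2 * q\<^sup>2) *
          ((LINT u:{0<..}|lborel. R 1 u) + (LINT u:{0<..}|lborel. R (- 1) u))"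
    unfolding split
    by (subst set_integral_diff(2))
       (auto intro!: set_integrable_mult_right set_integral_add(1) int int_exp
             simp: set_integral_add(2)[OF int int] lint_exp simp del: times_divide_eq_left mult_minus_left)
  then have "norm ((LINT u:{0<..}|lborel. q / (q\<^sup>2 + (of_real u)\<^sup>2) * of_real (exp (- (a * u)))) - 1 / (of_real a * q))
      = 1 / (2 * (norm q)\<^sup>2) * norm ((LINT u:{0<..}|lborel. R 1 u) + (LINT u:{0<..}|lborel. R (- 1) u))"
    by (simp add: norm_mult norm_divide norm_power mult.commute)
  also have "\<dots> \<le> 1 / (2 * (norm q)\<^sup>2) * (pi / a\<^sup>2 + pi / a\<^sup>2)"
    using resolvent_moment_bound[OF assms, of 1] resolvent_moment_bound[OF assms, of "- 1"]
    by (intro mult_left_mono norm_triangle_le add_mono) (simp_all add: R_def)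
  also have "\<dots> = pi / (a * norm q)\<^sup>2"
    by (simp add: power_mult_distrib field_simps)
  finally show ?thesis .
qed

text \<open>Both the integral and its leading term are odd in \<open>q\<close>.\<close>

lemma laplace_binet_kernel:
  fixes q :: complex
  assumes "Re q \<noteq> 0" "0 < a"
  shows "norm ((LINT u:{0<..}|lborel. q / (q\<^sup>2 + (of_real u)\<^sup>2) * of_real (exp (- (a * u)))) - 1 / (of_real a * q))
    \<le> pi / (a * norm q)\<^sup>2"
proof (cases "0 < Re q")
  case True
  then show ?thesis using assms(2) by (rule laplace_binet_kernel_right)
next
  case False
  define A where "A p = (LINT u:{0<..}|lborel. p / (p\<^sup>2 + (of_real u)\<^sup>2) * of_real (exp (- (a * u))))" for p :: complex
  have odd: "A (- q) = - A q"
    unfolding A_def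
    by (subst set_integral_uminus[symmetric]) (use set_integrable_binet_kernel_exp[OF assms] in simp_all)
  have "norm (A (- q) - 1 / (of_real a * (- q))) \<le> pi / (a * norm (- q))\<^sup>2"
    using False assms laplace_binet_kernel_right[of "- q" a] by (simp add: A_def)
  moreover have "norm (A (- q) - 1 / (of_real a * (- q))) = norm (A q - 1 / (of_real a * q))"
    unfolding odd by (simp add: norm_minus_commute)
  ultimately show ?thesis by (simp add: A_def)
qed

section \<open>Binet's function\<close>

text \<open>For \<open>Re q > 0\<close> this is \<open>log \<Gamma>(q) - (q - 1/2) log q + q - (log 2\<pi>) / 2\<close>, by Binet's second
  formula after an integration by parts.  On the left half plane it is the odd extension, not the
  analytic continuation.\<close>

definition binet :: "complex \<Rightarrow> complex" where
  "binet q = - (1 / of_real pi) *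
     (LINT u:{0<..}|lborel. q / (q\<^sup>2 + (of_real u)\<^sup>2) * of_real (ln (1 - exp (- (2 * pi * u)))))"

text \<open>The expansion \<open>log (1 - x) = - \<Sum> x\<^sup>k / k\<close> at \<open>x = e\<^sup>-\<^sup>2\<^sup>\<pi>\<^sup>u\<close> may be integrated termwise because the
  \<open>L\<^sup>1\<close> norms of its terms against the bounded kernel are \<open>O(1 / k\<^sup>2)\<close>.\<close>

lemma binet_series:
  fixes q :: complex
  assumes "Re q \<noteq> 0"
  defines "K \<equiv> \<lambda>u. q / (q\<^sup>2 + (of_real u)\<^sup>2)"
  shows "set_integrable lborel {0<..} (\<lambda>u. K u * of_real (ln (1 - exp (- (2 * pi * u)))))"
    and "(\<lambda>n. 1 / (of_real pi * of_nat (Suc n)) *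
           (LINT u:{0<..}|lborel. K u * of_real (exp (- (2 * pi * Suc n * u))))) sums binet q"
proof -
  let ?a = "\<lambda>n. 2 * pi * Suc n"
  define f where "f n u = indicat_real {0<..} u *\<^sub>R
    (- (1 / of_nat (Suc n)) * (K u * of_real (exp (- (?a n * u)))))" for n u
  have sums_f: "(\<lambda>n. f n u) sums (indicat_real {0<..} u *\<^sub>R (K u * of_real (ln (1 - exp (- (2 * pi * u))))))"
    and summable_f: "summable (\<lambda>n. norm (f n u))" for u
  proof -
    define x where "x = exp (- (2 * pi * u))"
    have pow: "exp (- (?a n * u)) = x ^ Suc n" for n
      unfolding x_def exp_of_nat_mult[symmetric] by (simp add: algebra_simps)
    have both: "(\<lambda>n. f n u) sums (K u * of_real (ln (1 - x))) \<and> summable (\<lambda>n. norm (f n u))" if "0 < u"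
    proof
      have x: "0 < x" "x < 1" using that by (simp_all add: x_def)
      have "(\<lambda>n. - (x ^ n) / real n) sums ln (1 - x)"
        using ln_series'[of "- x"] x by simp
      then have s: "(\<lambda>n. - (x ^ Suc n) / real (Suc n)) sums ln (1 - x)"
        by (subst sums_Suc_iff) simp
      from sums_mult[OF sums_of_real[OF this], of "K u"]
      show "(\<lambda>n. f n u) sums (K u * of_real (ln (1 - x)))"
        using that unfolding f_def pow by (simp add: mult.commute mult.left_commute)
      have "summable (\<lambda>n. norm (K u) * - (- (x ^ Suc n) / real (Suc n)))"
        using s by (intro summable_mult summable_minus) (simp add: sums_iff)
      then show "summable (\<lambda>n. norm (f n u))"
        using that x unfolding f_def pow
        by (simp add: norm_mult norm_divide norm_power mult.commute mult.left_commute del: of_nat_Suc)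
    qed
    show "(\<lambda>n. f n u) sums (indicat_real {0<..} u *\<^sub>R (K u * of_real (ln (1 - exp (- (2 * pi * u))))))"
      using both by (cases "0 < u") (auto simp: f_def x_def)
    show "summable (\<lambda>n. norm (f n u))"
      using both by (cases "0 < u") (auto simp: f_def)
  qed
  have int_f: "integrable lborel (f n)" for n
    using set_integrable_binet_kernel_exp[OF assms(1), of "?a n"]
    unfolding f_def set_integrable_def K_def
    by (subst mult_scaleR_right[symmetric]) (intro integrable_mult_right, simp)
  have "(LINT u|lborel. norm (f n u)) \<le> 1 / (2 * pi * \<bar>Re q\<bar>) * (1 / (real n + 1)\<^sup>2)" for n
  proof -
    have "(LINT u|lborel. norm (f n u)) \<le> (LINT u|lborel. 1 / (real (Suc n) * \<bar>Re q\<bar>) * (indicat_real {0<..} u *\<^sub>R exp (- (?a n * u))))"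
    proof (intro integral_mono integrable_norm int_f integrable_mult_right)
      show "integrable lborel (\<lambda>u. indicat_real {0<..} u *\<^sub>R exp (- (?a n * u)))"
        using exp_half_line(1)[of "?a n"] by (simp add: set_integrable_def)
      show "norm (f n u) \<le> 1 / (real (Suc n) * \<bar>Re q\<bar>) * (indicat_real {0<..} u *\<^sub>R exp (- (?a n * u)))" for u
      proof -
        have "norm (f n u) = indicat_real {0<..} u * exp (- (?a n * u)) / real (Suc n) * norm (K u)"
          unfolding f_def by (simp add: norm_mult norm_divide norm_power del: of_nat_Suc)
        also have "\<dots> \<le> indicat_real {0<..} u * exp (- (?a n * u)) / real (Suc n) * (1 / \<bar>Re q\<bar>)"
          using norm_binet_kernel_le[OF assms(1), of u] unfolding K_def by (intro mult_left_mono) auto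
        finally show ?thesis by (simp add: mult_ac)
      qed
    qed
    also have "\<dots> = 1 / (real (Suc n) * \<bar>Re q\<bar>) * (1 / ?a n)"
      using exp_half_line(2)[of "?a n"] unfolding set_lebesgue_integral_def by simp
    also have "\<dots> = 1 / (2 * pi * \<bar>Re q\<bar>) * (1 / (real n + 1)\<^sup>2)"
      by (simp add: power2_eq_square mult_ac add_ac)
    finally show ?thesis .
  qed
  then have "norm (LINT u|lborel. norm (f n u)) \<le> 1 / (2 * pi * \<bar>Re q\<bar>) * (1 / (real n + 1)\<^sup>2)" for n
    by (subst real_norm_def, subst abs_of_nonneg) (auto intro: integral_nonneg_AE)
  moreover have "summable (\<lambda>n. 1 / (2 * pi * \<bar>Re q\<bar>) * (1 / (real n + 1)\<^sup>2))"
    using sums_summable[OF inverse_squares_sums] by (intro summable_mult) (simp add: add_ac)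
  ultimately have summable_int: "summable (\<lambda>n. LINT u|lborel. norm (f n u))"
    by (rule summable_comparison_test'[rotated])
  have suminf_f: "(\<Sum>n. f n u) = indicat_real {0<..} u *\<^sub>R (K u * of_real (ln (1 - exp (- (2 * pi * u)))))" for u
    using sums_f[of u] by (simp add: sums_iff)
  show "set_integrable lborel {0<..} (\<lambda>u. K u * of_real (ln (1 - exp (- (2 * pi * u)))))"
    using integrable_suminf[OF int_f _ summable_int] summable_f
    unfolding set_integrable_def suminf_f by simp
  have "(\<lambda>n. LINT u|lborel. f n u) sums
      (LINT u:{0<..}|lborel. K u * of_real (ln (1 - exp (- (2 * pi * u)))))"
    using sums_integral[OF int_f _ summable_int] summable_f
    unfolding set_lebesgue_integral_def suminf_f by simp
  from sums_mult[OF this, of "- (1 / of_real pi)"]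
  have "(\<lambda>n. - (1 / of_real pi) * (LINT u|lborel. f n u)) sums binet q"
    by (simp add: binet_def K_def)
  moreover have "- (1 / of_real pi) * (LINT u|lborel. f n u) = 1 / (of_real pi * of_nat (Suc n)) *
      (LINT u:{0<..}|lborel. K u * of_real (exp (- (?a n * u))))" for n
  proof -
    have "(LINT u|lborel. f n u) = - (1 / of_nat (Suc n)) * (LINT u:{0<..}|lborel. K u * of_real (exp (- (?a n * u))))"
      unfolding f_def set_lebesgue_integral_def
      by (subst mult_scaleR_right[symmetric], subst integral_mult_right_zero) simp
    then show ?thesis by simp
  qed
  ultimately show "(\<lambda>n. 1 / (of_real pi * of_nat (Suc n)) *
           (LINT u:{0<..}|lborel. K u * of_real (exp (- (?a n * u))))) sums binet q"
    by simp
qed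

text \<open>Termwise application of \<open>laplace_binet_kernel\<close> with \<open>a = 2 \<pi> k\<close>.  The leading terms
  \<open>1 / (2 \<pi>\<^sup>2 k\<^sup>2 q)\<close> sum to \<open>1 / (12 q)\<close>.  The errors are \<open>1 / (4 \<pi>\<^sup>2 k\<^sup>3 |q|\<^sup>2)\<close>, where \<open>k\<^sup>3\<close> is
  replaced by \<open>k\<^sup>2\<close> to reuse the same series.\<close>

lemma binet_asymptotics:
  fixes q :: complex
  assumes "Re q \<noteq> 0"
  shows "norm (binet q - 1 / (12 * q)) \<le> 1 / (24 * (norm q)\<^sup>2)"
proof -
  define A where "A n = (LINT u:{0<..}|lborel. q / (q\<^sup>2 + (of_real u)\<^sup>2) *
    of_real (exp (- (2 * pi * Suc n * u))))" for n
  define c where "c n = 1 / (of_real pi * of_nat (Suc n)) *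
    (1 / (of_real (2 * pi * Suc n) * q))" for n
  have "q \<noteq> 0" using assms by auto
  have "(\<lambda>n. 1 / (2 * of_real pi ^ 2 * q) * of_real (1 / (real n + 1)\<^sup>2)) sums
      (1 / (2 * of_real pi ^ 2 * q) * of_real (pi\<^sup>2 / 6))"
    using inverse_squares_sums by (intro sums_mult sums_of_real) (simp add: add_ac)
  moreover have "1 / (2 * of_real pi ^ 2 * q) * of_real (1 / (real n + 1)\<^sup>2) = c n" for n
    unfolding c_def by (simp add: power2_eq_square mult_ac add_ac)
  moreover have "1 / (2 * of_real pi ^ 2 * q) * of_real (pi\<^sup>2 / 6) = 1 / (12 * q)"
    using \<open>q \<noteq> 0\<close> by (simp add: field_simps)
  ultimately have "c sums (1 / (12 * q))" by simp
  then have sums: "(\<lambda>n. 1 / (of_real pi * of_nat (Suc n)) * A n - c n) sums (binet q - 1 / (12 * q))"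
    using binet_series(2)[OF assms] unfolding A_def by (intro sums_diff)
  have bsums: "(\<lambda>n. 1 / (4 * pi\<^sup>2 * (norm q)\<^sup>2) * (1 / (real n + 1)\<^sup>2)) sums
      (1 / (4 * pi\<^sup>2 * (norm q)\<^sup>2) * (pi\<^sup>2 / 6))"
    using inverse_squares_sums by (intro sums_mult) (simp add: add_ac)
  have bound: "norm (1 / (of_real pi * of_nat (Suc n)) * A n - c n)
      \<le> 1 / (4 * pi\<^sup>2 * (norm q)\<^sup>2) * (1 / (real n + 1)\<^sup>2)" for n
  proof -
    have "norm (1 / (of_real pi * of_nat (Suc n)) * A n - c n)
        = 1 / (pi * real (Suc n)) * norm (A n - 1 / (of_real (2 * pi * Suc n) * q))"
      unfolding c_def right_diff_distrib[symmetric] norm_mult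
      by (simp add: norm_divide norm_mult del: of_nat_Suc)
    also have "\<dots> \<le> 1 / (pi * real (Suc n)) * (pi / (2 * pi * Suc n * norm q)\<^sup>2)"
      using laplace_binet_kernel[OF assms, of "2 * pi * Suc n"] unfolding A_def
      by (intro mult_left_mono) auto
    also have "\<dots> = 1 / real (Suc n) * (1 / (4 * pi\<^sup>2 * (norm q)\<^sup>2) * (1 / (real n + 1)\<^sup>2))"
    proof -
      have "1 / (pi * r) * (pi / (2 * pi * r * norm q)\<^sup>2) = 1 / r * (1 / (4 * pi\<^sup>2 * (norm q)\<^sup>2) * (1 / r\<^sup>2))" for r
        by (simp add: power2_eq_square)
      then show ?thesis by (simp only: of_nat_Suc add.commute)
    qed
    also have "\<dots> \<le> 1 * (1 / (4 * pi\<^sup>2 * (norm q)\<^sup>2) * (1 / (real n + 1)\<^sup>2))"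
      by (intro mult_right_mono) auto
    finally show ?thesis by simp
  qed
  have "norm (binet q - 1 / (12 * q)) \<le> 1 / (4 * pi\<^sup>2 * (norm q)\<^sup>2) * (pi\<^sup>2 / 6)"
    using norm_suminf_le[OF bound sums_summable[OF bsums]] sums_unique[OF sums] sums_unique[OF bsums] by simp
  also have "\<dots> = 1 / (24 * (norm q)\<^sup>2)" by simp
  finally show ?thesis .
qed

section \<open>The contour integrals as values of Binet's function\<close>

lemma set_lebesgue_integral_inverse:
  fixes f :: "real \<Rightarrow> complex"
  assumes "continuous_on {0<..} f"
    and "set_integrable lborel {0<..} (\<lambda>u. f (1 / u) / of_real (u\<^sup>2))"
  shows "(LINT s:{0<..}|lborel. f s) = (LINT u:{0<..}|lborel. f (1 / u) / of_real (u\<^sup>2))"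
proof -
  let ?S = "{0<..} :: real set"
  let ?g = "\<lambda>u. \<bar>- 1 / u\<^sup>2\<bar> *\<^sub>R f (1 / u)"
  have g: "f (1 / u) / of_real (u\<^sup>2) = ?g u" for u
    by (simp add: scaleR_conv_of_real)
  have gb: "set_integrable lborel ?S ?g"
    using assms(2) unfolding g .
  then have gl: "?g absolutely_integrable_on ?S"
    unfolding set_integrable_def
    by (subst integrable_completion) auto
  have lint_g: "(LINT u:?S|lborel. ?g u) = integral ?S ?g"
    by (rule set_borel_integral_eq_integral(2)[OF gb])
  have deriv: "((\<lambda>u. 1 / u) has_field_derivative - 1 / u\<^sup>2) (at u within ?S)" if "u \<in> ?S" for u
    using that by (auto intro!: derivative_eq_intros simp: power2_eq_square)
  have inj: "inj_on (\<lambda>u::real. 1 / u) ?S" by (auto intro: inj_onI)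
  have img: "(\<lambda>u::real. 1 / u) ` ?S = ?S"
  proof (intro equalityI subsetI)
    show "s \<in> (\<lambda>u::real. 1 / u) ` ?S" if "s \<in> ?S" for s
      using that by (intro image_eqI[of _ _ "1 / s"]) auto
  qed auto
  have f: "f absolutely_integrable_on ?S" "integral ?S f = integral ?S ?g"
    using has_absolute_integral_change_of_variables_real
        [of ?S "\<lambda>u. 1 / u" "\<lambda>u. - 1 / u\<^sup>2" f "integral ?S ?g", OF _ deriv inj] gl
    unfolding img by auto
  have "set_borel_measurable lborel ?S f"
    using set_measurable_continuous_on[of ?S f] assms(1)
    by (simp add: set_borel_measurable_def)
  then have "set_integrable lborel ?S f"
    using f(1) unfolding set_integrable_def set_borel_measurable_def
    by (subst (asm) integrable_completion) auto
  then have "(LINT s:?S|lborel. f s) = integral ?S f"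
    by (rule set_borel_integral_eq_integral(2))
  then show ?thesis
    unfolding g lint_g f(2) .
qed

text \<open>On the contour \<open>\<lambda>' = - \<i> w s\<close> the exponential is \<open>e\<^sup>-\<^sup>2\<^sup>\<pi>\<^sup>/\<^sup>s\<close> for every \<open>w\<close>, so \<open>w = t + n\<close> and \<open>z\<close>
  occur only in the rational factor \<open>z w / (w\<^sup>2 s\<^sup>2 + z\<^sup>2)\<close>.  That factor is homogeneous of degree \<open>0\<close> in
  \<open>(w, z)\<close>, and \<open>s = 1 / u\<close> turns it into Binet's kernel at \<open>w / z\<close>.\<close>

lemma I_BPS_eq_binet:
  assumes "Re ((t + of_int n) / z) \<noteq> 0"
  shows "I_BPS n t z = binet ((t + of_int n) / z)"
proof -
  define w where "w = t + of_int n"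
  define q where "q = w / z"
  have Re: "Re q \<noteq> 0" using assms by (simp add: q_def w_def)
  then have "z \<noteq> 0" "w \<noteq> 0" by (auto simp: q_def)
  define L where "L s = ln (1 - exp (- (2 * pi / s)))" for s :: real
  define f where "f s = z * w / (w\<^sup>2 * (of_real s)\<^sup>2 + z\<^sup>2) * of_real (L s)" for s
  have denom: "w\<^sup>2 * (of_real s)\<^sup>2 + z\<^sup>2 \<noteq> 0" if "0 < s" for s
  proof -
    have "w\<^sup>2 * (of_real s)\<^sup>2 + z\<^sup>2 = (z * of_real s)\<^sup>2 * (q\<^sup>2 + (of_real (1 / s))\<^sup>2)"
      using that \<open>z \<noteq> 0\<close> by (simp add: q_def field_simps)
    then show ?thesis
      using Re_nonzero_shift(3)[OF Re, of "1 / s"] that \<open>z \<noteq> 0\<close> by simp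
  qed
  have "continuous_on {0<..} f"
    unfolding f_def L_def using denom by (intro continuous_intros) auto
  moreover have subst: "f (1 / u) / of_real (u\<^sup>2)
      = q / (q\<^sup>2 + (of_real u)\<^sup>2) * of_real (ln (1 - exp (- (2 * pi * u))))" if "0 < u" for u
  proof -
    have "z * w / (w\<^sup>2 * (of_real (1 / u))\<^sup>2 + z\<^sup>2) / of_real (u\<^sup>2) = q / (q\<^sup>2 + (of_real u)\<^sup>2)"
    proof -
      have "q\<^sup>2 + (of_real u)\<^sup>2 \<noteq> 0" by (rule Re_nonzero_shift(3)[OF Re])
      moreover have "w\<^sup>2 * (of_real (1 / u))\<^sup>2 + z\<^sup>2 \<noteq> 0" using denom[of "1 / u"] that by simp
      moreover have "w = q * z" using \<open>z \<noteq> 0\<close> by (simp add: q_def)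
      ultimately show ?thesis
        using that \<open>z \<noteq> 0\<close> by (simp add: divide_simps) (simp add: algebra_simps power2_eq_square)
    qed
    then have "z * w / (w\<^sup>2 * (of_real (1 / u))\<^sup>2 + z\<^sup>2) / of_real (u\<^sup>2) * of_real (L (1 / u))
        = q / (q\<^sup>2 + (of_real u)\<^sup>2) * of_real (L (1 / u))"
      by simp
    then show ?thesis
      by (simp add: f_def L_def)
  qed
  moreover have "set_integrable lborel {0<..} (\<lambda>u. f (1 / u) / of_real (u\<^sup>2))"
    using binet_series(1)[OF Re] subst by (subst set_integrable_cong[OF refl refl]) auto
  ultimately have "(LINT s:{0<..}|lborel. f s) = (LINT u:{0<..}|lborel. f (1 / u) / of_real (u\<^sup>2))"
    by (intro set_lebesgue_integral_inverse)
  also have "\<dots> = (LINT u:{0<..}|lborel. q / (q\<^sup>2 + (of_real u)\<^sup>2) * of_real (ln (1 - exp (- (2 * pi * u)))))"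
    using subst by (intro set_lebesgue_integral_cong) auto
  finally have "binet q = - (1 / of_real pi) * (LINT s:{0<..}|lborel. f s)"
    by (simp add: binet_def)
  moreover have "I_BPS n t z = - (1 / of_real pi) * (LINT s:{0<..}|lborel. f s)"
  proof -
    have "1 / ((of_real s * (- \<i> * w))\<^sup>2 - z\<^sup>2) * Ln (1 - exp (2 * of_real pi * \<i> * w / (of_real s * (- \<i> * w)))) * (- \<i> * w)
        = \<i> / z * f s" if "0 < s" for s :: real
    proof -
      have "2 * of_real pi * \<i> * w / (of_real s * (- \<i> * w)) = of_real (- (2 * pi / s))"
        using that \<open>w \<noteq> 0\<close> by (simp add: field_simps)
      then have "Ln (1 - exp (2 * of_real pi * \<i> * w / (of_real s * (- \<i> * w)))) = Ln (of_real (1 - exp (- (2 * pi / s))))"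
        by (simp only: exp_of_real of_real_diff of_real_1)
      also have "\<dots> = of_real (L s)"
        unfolding L_def using that by (intro Ln_of_real) simp
      finally have log: "Ln (1 - exp (2 * of_real pi * \<i> * w / (of_real s * (- \<i> * w)))) = of_real (L s)" .
      define D where "D = w\<^sup>2 * (of_real s)\<^sup>2 + z\<^sup>2"
      have "(of_real s * (- \<i> * w))\<^sup>2 - z\<^sup>2 = - D"
        by (simp add: D_def power_mult_distrib)
      then show ?thesis
        unfolding log f_def D_def[symmetric] using \<open>z \<noteq> 0\<close> by simp
    qed
    then have "ray_integral (- \<i> * w) (\<lambda>x. 1 / (x\<^sup>2 - z\<^sup>2) * Ln (1 - exp (2 * of_real pi * \<i> * w / x)))
        = (LINT s:{0<..}|lborel. \<i> / z * f s)"
      unfolding ray_integral_def by (intro set_lebesgue_integral_cong) auto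
    then show ?thesis
      unfolding I_BPS_def w_def[symmetric] set_integral_mult_right
      using \<open>z \<noteq> 0\<close> by simp
  qed
  ultimately show ?thesis by (simp add: q_def w_def)
qed

section \<open>Sectors and BPS rays\<close>

lemma sector_contains_ray:
  assumes "is_sector S" "z \<in> S"
  shows "ray z \<subseteq> S" "z \<noteq> 0"
proof -
  obtain J where S: "S = {of_real r * cis \<theta> | r \<theta>. r > 0 \<and> \<theta> \<in> J}"
    using assms(1) unfolding is_sector_def by blast
  obtain r \<theta> where z: "z = of_real r * cis \<theta>" "0 < r" "\<theta> \<in> J"
    using assms(2) unfolding S by blast
  then show "z \<noteq> 0" by simp
  show "ray z \<subseteq> S"
  proof
    fix x assume "x \<in> ray z"
    then obtain s where "0 < s" "x = of_real s * z" unfolding ray_def by blast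
    then have "x = of_real (s * r) * cis \<theta>" "0 < s * r" using z by simp_all
    then show "x \<in> S" unfolding S using z(3) by blast
  qed
qed

lemma ray_scale:
  assumes "0 < c"
  shows "ray (of_real c * v) = ray v"
proof (intro equalityI subsetI)
  fix x assume "x \<in> ray (of_real c * v)"
  then obtain s where "0 < s" "x = of_real (s * c) * v" unfolding ray_def by auto
  with assms show "x \<in> ray v" unfolding ray_def by (auto intro!: exI[of _ "s * c"])
next
  fix x assume "x \<in> ray v"
  then obtain s where "0 < s" "x = of_real s * v" unfolding ray_def by auto
  with assms show "x \<in> ray (of_real c * v)"
    unfolding ray_def by (auto intro!: exI[of _ "s / c"])
qed

lemma off_BPS_rays:
  assumes "Im t \<noteq> 0" "z \<noteq> 0" "ray z \<notin> BPS_rays t"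
  shows "Re ((t + of_int n) / z) \<noteq> 0"
proof
  assume "Re ((t + of_int n) / z) = 0"
  then obtain y where y: "(t + of_int n) / z = \<i> * of_real y"
    by (metis add_0 complex_eq of_real_0)
  have "t + of_int n \<noteq> 0" using assms(1) by (auto simp: complex_eq_iff)
  with y assms(2) have "y \<noteq> 0" by auto
  have z: "z = of_real (1 / y) * (- \<i> * (t + of_int n))"
    using y assms(2) \<open>y \<noteq> 0\<close> by (simp add: field_simps)
  have "ray z \<in> BPS_rays t"
  proof (cases "0 < y")
    case True
    then have "ray z = ray (- \<i> * (t + of_int n))"
      unfolding z by (intro ray_scale) simp
    then show ?thesis unfolding BPS_rays_def by blast
  next
    case False
    have "z = of_real (1 / - y) * (\<i> * (t + of_int n))" unfolding z by simp
    then have "ray z = ray (\<i> * (t + of_int n))"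
      using ray_scale[of "1 / - y"] False \<open>y \<noteq> 0\<close> by simp
    then show ?thesis unfolding BPS_rays_def by blast
  qed
  with assms(3) show False by simp
qed

section \<open>The symmetric sum\<close>

lemma summable_inverse_square_shift:
  fixes t :: complex
  shows "summable (\<lambda>k. 1 / (norm (t + of_nat (Suc k)))\<^sup>2)"
proof (rule summable_comparison_test_ev)
  show "summable (\<lambda>k. 4 * (1 / (real k + 1)\<^sup>2))"
    using sums_summable[OF inverse_squares_sums] by (intro summable_mult) (simp add: add_ac)
  have "\<forall>\<^sub>F k in sequentially. 2 * norm t \<le> real k"
    by (rule eventually_sequentiallyI[of "nat \<lceil>2 * norm t\<rceil>"]) linarith
  then show "\<forall>\<^sub>F k in sequentially. norm (1 / (norm (t + of_nat (Suc k)))\<^sup>2) \<le> 4 * (1 / (real k + 1)\<^sup>2)"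
  proof eventually_elim
    case (elim k)
    have "norm (of_nat (Suc k) :: complex) \<le> norm (t + of_nat (Suc k)) + norm t"
      using norm_triangle_ineq4[of "t + of_nat (Suc k)" t] by simp
    then have h: "(real k + 1) / 2 \<le> norm (t + of_nat (Suc k))"
      using elim unfolding norm_of_nat by simp
    have "1 / (norm (t + of_nat (Suc k)))\<^sup>2 \<le> 1 / ((real k + 1) / 2)\<^sup>2"
      using h by (intro divide_left_mono power_mono mult_pos_pos) (auto intro!: zero_less_power simp del: of_nat_Suc)
    then show ?case by (simp add: power_divide)
  qed
qed

text \<open>The quadratic errors \<open>|z|\<^sup>2 / |t \<plusminus> k|\<^sup>2\<close> are summable over \<open>k\<close>.  So are the paired leading terms,
  because \<open>1 / (t + k) + 1 / (t - k) = 2 t / ((t + k) (t - k))\<close> and the geometric mean of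
  \<open>1 / |t + k|\<^sup>2\<close> and \<open>1 / |t - k|\<^sup>2\<close> is at most their arithmetic mean.  Both are thus controlled by
  the same sequence \<open>b\<close>, independently of the direction of \<open>z\<close>.\<close>

lemma log_X_inst_bound:
  assumes "Im t \<noteq> 0"
  obtains C where "\<And>z. \<lbrakk>z \<noteq> 0; \<And>n. Re ((t + of_int n) / z) \<noteq> 0\<rbrakk>
    \<Longrightarrow> norm (log_X_inst t z) \<le> C * (norm z + (norm z)\<^sup>2)"
proof -
  define b where "b k = 1 / (norm (t + of_nat (Suc k)))\<^sup>2 + 1 / (norm (t - of_nat (Suc k)))\<^sup>2" for k
  \<comment> \<open>One constant that dominates both \<open>1\<close>, for the quadratic errors, and \<open>|t|\<close>, for the paired
    leading terms.\<close>
  define M where "M = norm t + 1"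
  define C where "C = M * (1 / norm t + 1 / (norm t)\<^sup>2) + M * (\<Sum>k. b k)"
  have "summable (\<lambda>k. 1 / (norm (- t + of_nat (Suc k)))\<^sup>2)"
    by (rule summable_inverse_square_shift)
  moreover have "norm (- t + of_nat (Suc k)) = norm (t - of_nat (Suc k))" for k
    by (simp add: norm_minus_commute del: of_nat_Suc)
  ultimately have sb: "summable b"
    unfolding b_def using summable_inverse_square_shift[of t] by (intro summable_add) simp_all
  have M: "1 \<le> M" "norm t \<le> M" by (simp_all add: M_def)
  have nz: "t + of_int n \<noteq> 0" for n
    using assms by (auto simp: complex_eq_iff)
  have "norm (log_X_inst t z) \<le> C * (norm z + (norm z)\<^sup>2)"
    if z: "z \<noteq> 0" and Re: "\<And>n. Re ((t + of_int n) / z) \<noteq> 0" for z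
  proof -
    define x where "x = norm z"
    have x: "0 < x" using z by (simp add: x_def)
    have asym: "norm (I_BPS n t z - z / (12 * (t + of_int n))) \<le> x\<^sup>2 / (24 * (norm (t + of_int n))\<^sup>2)" for n
      using binet_asymptotics[OF Re[of n]] I_BPS_eq_binet[OF Re[of n]]
      by (simp add: norm_divide power_divide x_def)
    have zero: "norm (I_BPS 0 t z) \<le> M * (1 / norm t + 1 / (norm t)\<^sup>2) * (x + x\<^sup>2)"
    proof -
      have "norm (I_BPS 0 t z) \<le> norm (I_BPS 0 t z - z / (12 * t)) + norm (z / (12 * t))"
        using norm_triangle_ineq[of "I_BPS 0 t z - z / (12 * t)" "z / (12 * t)"] by simp
      also have "\<dots> \<le> x\<^sup>2 / (24 * (norm t)\<^sup>2) + x / (12 * norm t)"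
        using asym[of 0] by (intro add_mono) (simp_all add: norm_divide norm_mult x_def)
      also have "\<dots> = 1 / (norm t)\<^sup>2 * (x\<^sup>2 / 24) + 1 / norm t * (x / 12)"
        by simp
      also have "\<dots> \<le> 1 / (norm t)\<^sup>2 * (x + x\<^sup>2) + 1 / norm t * (x + x\<^sup>2)"
        using x by (intro add_mono mult_left_mono) auto
      also have "\<dots> = 1 * ((1 / norm t + 1 / (norm t)\<^sup>2) * (x + x\<^sup>2))"
        by (simp add: algebra_simps)
      also have "\<dots> \<le> M * ((1 / norm t + 1 / (norm t)\<^sup>2) * (x + x\<^sup>2))"
        using x M by (intro mult_right_mono) auto
      finally show ?thesis by (simp only: mult.assoc)
    qed
    have pair: "norm (I_BPS (int (Suc k)) t z + I_BPS (- int (Suc k)) t z) \<le> M * (x + x\<^sup>2) * b k" for k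
    proof -
      define u where "u = t + of_nat (Suc k)"
      define w where "w = t - of_nat (Suc k)"
      define p where "p = 1 / norm u"
      define m where "m = 1 / norm w"
      have b: "b k = p\<^sup>2 + m\<^sup>2"
        by (simp add: b_def p_def m_def u_def w_def power_divide)
      have uw: "u = t + of_int (int (Suc k))" "w = t + of_int (- int (Suc k))"
        by (simp_all add: u_def w_def)
      then have "u \<noteq> 0" "w \<noteq> 0"
        using nz by metis+
      then have "z / (12 * u) + z / (12 * w) = z * (u + w) / (12 * (u * w))"
        by (simp add: field_simps)
      also have "u + w = 2 * t" by (simp add: u_def w_def)
      finally have lead: "norm (z / (12 * u) + z / (12 * w)) = x * norm t / 12 * (2 * (p * m))"
        by (simp add: norm_divide norm_mult x_def p_def m_def)
      have "norm (I_BPS (int (Suc k)) t z - z / (12 * u)) \<le> x\<^sup>2 / 24 * p\<^sup>2"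
        "norm (I_BPS (- int (Suc k)) t z - z / (12 * w)) \<le> x\<^sup>2 / 24 * m\<^sup>2"
        using asym[of "int (Suc k)"] asym[of "- int (Suc k)"]
        unfolding uw[symmetric] by (simp_all add: p_def m_def power_divide)
      moreover have "norm (I_BPS (int (Suc k)) t z + I_BPS (- int (Suc k)) t z)
          \<le> norm (I_BPS (int (Suc k)) t z - z / (12 * u)) + norm (I_BPS (- int (Suc k)) t z - z / (12 * w))
            + norm (z / (12 * u) + z / (12 * w))"
      proof -
        have "I_BPS (int (Suc k)) t z + I_BPS (- int (Suc k)) t z
            = (I_BPS (int (Suc k)) t z - z / (12 * u)) + (I_BPS (- int (Suc k)) t z - z / (12 * w))
            + (z / (12 * u) + z / (12 * w))" by simp
        then show ?thesis
          by (simp only: norm_triangle_le norm_triangle_ineq add_right_mono)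
      qed
      moreover have "x * norm t / 12 * (2 * (p * m)) \<le> x * M / 12 * (p\<^sup>2 + m\<^sup>2)"
        using x M sum_squares_bound[of p m]
        by (intro mult_mono divide_right_mono mult_left_mono) (auto simp: p_def m_def)
      ultimately have "norm (I_BPS (int (Suc k)) t z + I_BPS (- int (Suc k)) t z)
          \<le> x\<^sup>2 / 24 * p\<^sup>2 + x\<^sup>2 / 24 * m\<^sup>2 + x * M / 12 * (p\<^sup>2 + m\<^sup>2)"
        unfolding lead by linarith
      also have "\<dots> = (x * M / 12 + 1 * x\<^sup>2 / 24) * (p\<^sup>2 + m\<^sup>2)"
        by (simp add: field_simps)
      also have "\<dots> \<le> (x * M + M * x\<^sup>2) * (p\<^sup>2 + m\<^sup>2)"
      proof (intro mult_right_mono add_mono)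
        have "1 * x\<^sup>2 \<le> M * x\<^sup>2" using M by (intro mult_right_mono) auto
        then show "1 * x\<^sup>2 / 24 \<le> M * x\<^sup>2" using zero_le_power2[of x] by linarith
        have "0 \<le> x * M" using x M by simp
        then show "x * M / 12 \<le> x * M" by linarith
      qed auto
      finally show ?thesis
        unfolding b by (simp add: algebra_simps)
    qed
    have "norm (\<Sum>k. I_BPS (int (Suc k)) t z + I_BPS (- int (Suc k)) t z) \<le> (\<Sum>k. M * (x + x\<^sup>2) * b k)"
      using pair by (rule norm_suminf_le) (intro summable_mult sb)
    also have "\<dots> = M * (x + x\<^sup>2) * (\<Sum>k. b k)"
      using sb by (rule suminf_mult)
    finally show ?thesis
      unfolding log_X_inst_def C_def x_def[symmetric] using zero
      by (intro norm_triangle_le) (simp add: algebra_simps)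
  qed
  then show thesis by (rule that)
qed

theorem proposition42:
  fixes t v :: complex and l S :: "complex set"
  assumes "Im t \<noteq> 0"
    and "v \<noteq> 0" and "l = ray v"
    and "l \<notin> BPS_rays t"
    and "is_sector S"
    and "l \<subseteq> S"
    and "\<And>r. r \<in> BPS_rays t \<Longrightarrow> \<not> r \<subseteq> S"
  shows "((\<lambda>z. X_beta t z * exp (- (2 * of_real pi * \<i> * Z_beta t / z))) \<longlongrightarrow> 1) (at 0 within S)"
proof -
  obtain C where C: "\<And>z. \<lbrakk>z \<noteq> 0; \<And>n. Re ((t + of_int n) / z) \<noteq> 0\<rbrakk>
      \<Longrightarrow> norm (log_X_inst t z) \<le> C * (norm z + (norm z)\<^sup>2)"
    using log_X_inst_bound[OF assms(1)] by blast
  have "norm (log_X_inst t z) \<le> C * (norm z + (norm z)\<^sup>2)" if "z \<in> S" for z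
    using C off_BPS_rays[OF assms(1)] sector_contains_ray[OF assms(5) that] assms(7) by blast
  then have bound: "\<forall>\<^sub>F z in at 0 within S. norm (log_X_inst t z) \<le> C * (norm z + (norm z)\<^sup>2)"
    by (auto simp: eventually_at_filter)
  have "((\<lambda>z. C * (norm z + (norm z)\<^sup>2)) \<longlongrightarrow> C * (norm (0::complex) + (norm (0::complex))\<^sup>2)) (at 0 within S)"
    by (intro tendsto_intros)
  then have "((\<lambda>z. C * (norm z + (norm z)\<^sup>2)) \<longlongrightarrow> 0) (at 0 within S)" by simp
  with bound have "(log_X_inst t \<longlongrightarrow> 0) (at 0 within S)"
    by (rule Lim_null_comparison)
  from tendsto_exp[OF this] have "(X_inst t \<longlongrightarrow> 1) (at 0 within S)"
    by (simp add: X_inst_def[abs_def])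
  moreover have "X_beta t z * exp (- (2 * of_real pi * \<i> * Z_beta t / z)) = X_inst t z" for z
    by (simp add: X_beta_def mult_ac flip: exp_add)
  ultimately show ?thesis by simp
qed

end
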